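(* Let $A,B,C,D\in\mathbb{C}^{n\times n}$ have core inverses, and let $M=\begin{pmatrix}A&B\\ C&D\end{pmatrix}\in\mathbb{C}^{2n\times 2n}$. If $AB=BD$, $DC=CA$, $A^*B=BD^*$, $D^*C=CA^*$, $B(CB)^{\pi}=0$, $C(BC)^{\pi}=0$, and $A^{\mathrm{core}}BD^{\mathrm{core}}C$ is nilpotent, then $M$ has a core inverse.
   Context: For a complex square matrix $X$, $X^*$ denotes its conjugate transpose. $X$ has a core inverse if there is a matrix $Y$ of the same size with $YX^2=X$, $XY^2=Y$, $(XY)^*=XY$; such $Y$ is unique and is denoted $X^{\mathrm{core}}$. $X^{\pi}:=I-XX^{D}$, where $X^{D}$ is the Drazin inverse of $X$ (which always exists for complex square matrices); if $X$ has a group inverse $X^{\#}$ (the unique $Y$ with $XYX=X$, $YXY=Y$, $XY=YX$), then $X^{D}=X^{\#}$ and $X^{\pi}=I-XX^{\#}$. *)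

theory Defs
  imports "Jordan_Normal_Form.Schur_Decomposition"
begin

definition is_core_inverse :: "complex mat \<Rightarrow> complex mat \<Rightarrow> bool" where
  "is_core_inverse X Y \<longleftrightarrow>
     square_mat X \<and> Y \<in> carrier_mat (dim_row X) (dim_row X) \<and>
     Y * (X ^\<^sub>m 2) = X \<and> X * (Y ^\<^sub>m 2) = Y \<and> mat_adjoint (X * Y) = X * Y"

definition has_core_inverse :: "complex mat \<Rightarrow> bool" where
  "has_core_inverse X \<longleftrightarrow> (\<exists>Y. is_core_inverse X Y)"

(* Unspecified unless has_core_inverse X; uniqueness is is_core_inverse_unique below. *)
definition core_inverse :: "complex mat \<Rightarrow> complex mat" where
  "core_inverse X = (THE Y. is_core_inverse X Y)"

definition is_drazin_inverse :: "complex mat \<Rightarrow> complex mat \<Rightarrow> bool" where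
  "is_drazin_inverse X Y \<longleftrightarrow>
     square_mat X \<and> Y \<in> carrier_mat (dim_row X) (dim_row X) \<and>
     X * Y = Y * X \<and> Y * X * Y = Y \<and> (\<exists>k. (X ^\<^sub>m (Suc k)) * Y = X ^\<^sub>m k)"

(* Every complex square matrix has exactly one Drazin inverse; the uniqueness
   half is is_drazin_inverse_unique below. *)
definition drazin_inverse :: "complex mat \<Rightarrow> complex mat" where
  "drazin_inverse X = (THE Y. is_drazin_inverse X Y)"

(* Written X^pi: the projection onto the generalized kernel of X. *)
definition spectral_idempotent :: "complex mat \<Rightarrow> complex mat" where
  "spectral_idempotent X = 1\<^sub>m (dim_row X) - X * drazin_inverse X"

definition nilpotent_mat :: "complex mat \<Rightarrow> bool" where
  "nilpotent_mat X \<longleftrightarrow> square_mat X \<and> (\<exists>k. X ^\<^sub>m k = 0\<^sub>m (dim_row X) (dim_row X))"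

lemma cm_simps:
  fixes n :: nat
  defines "R \<equiv> carrier_mat n n :: complex mat set"
  shows "\<And>A B C. A \<in> R \<Longrightarrow> B \<in> R \<Longrightarrow> C \<in> R \<Longrightarrow> A * B * C = A * (B * C)"
    and "\<And>A B. A \<in> R \<Longrightarrow> B \<in> R \<Longrightarrow> A * B \<in> R"
  unfolding R_def by (auto intro: assoc_mult_mat)

lemma mat_adjoint_mult:
  fixes A B :: "complex mat"
  assumes A: "A \<in> carrier_mat n m" and B: "B \<in> carrier_mat m l"
  shows "mat_adjoint (A * B) = mat_adjoint B * mat_adjoint A"
proof (rule eq_matI)
  show "dim_row (mat_adjoint (A * B)) = dim_row (mat_adjoint B * mat_adjoint A)"
    "dim_col (mat_adjoint (A * B)) = dim_col (mat_adjoint B * mat_adjoint A)"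
    using A B by (auto simp: mat_adjoint_def)
next
  fix i j
  assume "i < dim_row (mat_adjoint B * mat_adjoint A)" "j < dim_col (mat_adjoint B * mat_adjoint A)"
  then have ij: "i < l" "j < n" using A B by (auto simp: mat_adjoint_def)
  show "mat_adjoint (A * B) $$ (i, j) = (mat_adjoint B * mat_adjoint A) $$ (i, j)"
    using A B ij
    by (auto simp: mat_adjoint_def mat_of_rows_def scalar_prod_def times_mat_def mult.commute
        intro!: sum.cong)
qed

lemma core_inverse_facts:
  assumes XY: "is_core_inverse X Y" and X: "X \<in> carrier_mat n n"
  shows "Y \<in> carrier_mat n n" "Y * (X * X) = X" "X * (Y * Y) = Y"
    "mat_adjoint (X * Y) = X * Y" "X * (Y * X) = X" "Y * (X * Y) = Y"
proof -
  show Y: "Y \<in> carrier_mat n n" and 1: "Y * (X * X) = X" and 2: "X * (Y * Y) = Y"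
    and "mat_adjoint (X * Y) = X * Y"
    using XY X by (auto simp: is_core_inverse_def numeral_2_eq_2)
  note s = cm_simps[of _ n] X Y
  have "X * (Y * X) = X * (Y * (Y * (X * X)))" by (simp only: 1)
  also have "\<dots> = (X * (Y * Y)) * (X * X)" by (simp only: s)
  also have "\<dots> = X" by (simp only: 1 2)
  finally show "X * (Y * X) = X" .
  have "Y * (X * Y) = Y * (X * (X * (Y * Y)))" by (simp only: 2)
  also have "\<dots> = (Y * (X * X)) * (Y * Y)" by (simp only: s)
  also have "\<dots> = Y" by (simp only: 1 2)
  finally show "Y * (X * Y) = Y" .
qed

lemma is_core_inverse_unique:
  assumes Y: "is_core_inverse X Y" and Z: "is_core_inverse X Z"
  shows "Y = Z"
proof -
  define n where "n = dim_row X"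
  have X: "X \<in> carrier_mat n n" using Y by (auto simp: is_core_inverse_def n_def)
  note y = core_inverse_facts[OF Y X] and z = core_inverse_facts[OF Z X]
  note s = cm_simps[of _ n] X y(1) z(1)
  have zy: "(X * Z) * (X * Y) = X * Y"
  proof -
    have "(X * Z) * (X * Y) = (X * (Z * X)) * Y" by (simp only: s)
    then show ?thesis by (simp only: z)
  qed
  have yz: "(X * Y) * (X * Z) = X * Z"
  proof -
    have "(X * Y) * (X * Z) = (X * (Y * X)) * Z" by (simp only: s)
    then show ?thesis by (simp only: y)
  qed
  have "X * Y = mat_adjoint ((X * Z) * (X * Y))" by (simp only: zy y)
  also have "\<dots> = mat_adjoint (X * Y) * mat_adjoint (X * Z)"
    by (rule mat_adjoint_mult[of _ n n _ n]) (simp_all only: s)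
  also have "\<dots> = X * Z" by (simp only: y z yz)
  finally have e: "X * Y = X * Z" .
  have "Y = Y * (X * Z)" using y(6) by (simp only: e)
  also have "\<dots> = Y * (X * (X * (Z * Z)))" by (simp only: z)
  also have "\<dots> = (Y * (X * X)) * (Z * Z)" by (simp only: s)
  also have "\<dots> = Z" by (simp only: y z)
  finally show ?thesis .
qed

lemma core_inverse_eq: "is_core_inverse X Y \<Longrightarrow> core_inverse X = Y"
  unfolding core_inverse_def using is_core_inverse_unique by blast

lemma drazin_inverse_facts:
  assumes Y: "is_drazin_inverse X Y" and X: "X \<in> carrier_mat n n"
  obtains k where "Y \<in> carrier_mat n n" "X * Y = Y * X" "Y * (X * Y) = Y"
    "\<And>m. k \<le> m \<Longrightarrow> X ^\<^sub>m m * (X * Y) = X ^\<^sub>m m"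
    "\<And>m. \<exists>W \<in> carrier_mat n n. X * Y = W * X ^\<^sub>m m"
    "\<And>m. k \<le> m \<Longrightarrow> (X * Y) * X ^\<^sub>m m = X ^\<^sub>m m"
    "\<And>m. \<exists>W \<in> carrier_mat n n. X * Y = X ^\<^sub>m m * W"
proof -
  from assms obtain k where Yc: "Y \<in> carrier_mat n n" and c: "X * Y = Y * X"
    and yxy: "Y * X * Y = Y" and k: "(X ^\<^sub>m k * X) * Y = X ^\<^sub>m k"
    by (auto simp: is_drazin_inverse_def)
  have p: "X ^\<^sub>m m \<in> carrier_mat n n" for m using X by simp
  note s = cm_simps[of _ n] X Yc p
  have pc: "X * X ^\<^sub>m m = X ^\<^sub>m m * X" for m
  proof (induction m)
    case (Suc m)
    have "X * X ^\<^sub>m (Suc m) = (X * X ^\<^sub>m m) * X" by (simp only: pow_mat.simps s)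
    then show ?case by (simp only: Suc pow_mat.simps)
  qed (use X in auto)
  have xe: "X * (X * Y) = X * (Y * X)" by (simp only: c)
  have cm: "X ^\<^sub>m m * (X * Y) = (X * Y) * X ^\<^sub>m m" for m
  proof (induction m)
    case (Suc m)
    have "X ^\<^sub>m (Suc m) * (X * Y) = X ^\<^sub>m m * (X * (X * Y))" by (simp only: pow_mat.simps s)
    also have "\<dots> = X ^\<^sub>m m * (X * Y) * X" by (simp only: s xe)
    also have "\<dots> = (X * Y) * X ^\<^sub>m m * X" by (simp only: Suc)
    also have "\<dots> = (X * Y) * X ^\<^sub>m (Suc m)" by (simp only: pow_mat.simps s)
    finally show ?case .
  qed (use X Yc in auto)
  have 1: "X ^\<^sub>m m * (X * Y) = X ^\<^sub>m m" if "k \<le> m" for m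
    using that
  proof (induction m rule: dec_induct)
    case base
    then show ?case using k by (simp only: s)
  next
    case (step m)
    have "X ^\<^sub>m (Suc m) * (X * Y) = X ^\<^sub>m m * (X * (X * Y))" by (simp only: pow_mat.simps s)
    also have "\<dots> = X ^\<^sub>m m * (X * Y) * X" by (simp only: s xe)
    also have "\<dots> = X ^\<^sub>m (Suc m)" by (simp only: step pow_mat.simps)
    finally show ?case .
  qed
  have W: "\<exists>W \<in> carrier_mat n n. X * Y = W * X ^\<^sub>m m" for m
  proof (induction m)
    case 0
    show ?case using X Yc by (intro bexI[of _ "X * Y"]) auto
  next
    case (Suc m)
    then obtain W where Wc: "W \<in> carrier_mat n n" and W: "X * Y = W * X ^\<^sub>m m" by blast
    have "X * Y = Y * X * Y * X" by (simp only: yxy c)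
    also have "\<dots> = Y * (X * Y) * X" by (simp only: s)
    also have "\<dots> = Y * (W * X ^\<^sub>m m) * X" by (simp only: W)
    also have "\<dots> = (Y * W) * X ^\<^sub>m (Suc m)" using Wc by (simp only: pow_mat.simps s)
    finally show ?case using Wc Yc by (intro bexI[of _ "Y * W"]) auto
  qed
  have W': "\<exists>W \<in> carrier_mat n n. X * Y = X ^\<^sub>m m * W" for m
  proof (induction m)
    case 0
    show ?case using X Yc by (intro bexI[of _ "X * Y"]) auto
  next
    case (Suc m)
    then obtain W where Wc: "W \<in> carrier_mat n n" and W: "X * Y = X ^\<^sub>m m * W" by blast
    have "X * Y = X * (Y * X * Y)" by (simp only: yxy)
    also have "\<dots> = X * (X * Y) * Y" by (simp only: c s)
    also have "\<dots> = X * (X ^\<^sub>m m * W) * Y" by (simp only: W)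
    also have "\<dots> = (X * X ^\<^sub>m m) * W * Y" using Wc by (simp only: s)
    also have "\<dots> = X ^\<^sub>m (Suc m) * (W * Y)" using Wc by (simp only: pc pow_mat.simps s)
    finally show ?case using Wc Yc by (intro bexI[of _ "W * Y"]) auto
  qed
  show ?thesis
    by (rule that[of k]) (use Yc c yxy X W W' 1 cm in \<open>auto simp: assoc_mult_mat[of _ n n _ n _ n]\<close>)
qed

lemma is_drazin_inverse_unique:
  assumes Y: "is_drazin_inverse X Y" and Z: "is_drazin_inverse X Z"
  shows "Y = Z"
proof -
  define n where "n = dim_row X"
  have X: "X \<in> carrier_mat n n" using Y by (auto simp: is_drazin_inverse_def n_def)
  obtain k where y: "Y \<in> carrier_mat n n" "X * Y = Y * X" "Y * (X * Y) = Y"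
    "\<And>m. k \<le> m \<Longrightarrow> X ^\<^sub>m m * (X * Y) = X ^\<^sub>m m"
    "\<And>m. \<exists>W \<in> carrier_mat n n. X * Y = X ^\<^sub>m m * W"
    "\<And>m. k \<le> m \<Longrightarrow> (X * Y) * X ^\<^sub>m m = X ^\<^sub>m m"
    by (rule drazin_inverse_facts[OF Y X]) blast
  obtain l where z: "Z \<in> carrier_mat n n" "X * Z = Z * X" "Z * (X * Z) = Z"
    "\<And>m. l \<le> m \<Longrightarrow> X ^\<^sub>m m * (X * Z) = X ^\<^sub>m m"
    "\<And>m. \<exists>W \<in> carrier_mat n n. X * Z = W * X ^\<^sub>m m"
    "\<And>m. l \<le> m \<Longrightarrow> (X * Z) * X ^\<^sub>m m = X ^\<^sub>m m"
    by (rule drazin_inverse_facts[OF Z X]) blast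
  define m where "m = max k l"
  have p: "X ^\<^sub>m m \<in> carrier_mat n n" using X by simp
  note s = cm_simps[of _ n] X y(1) z(1) p
  obtain W where Wc: "W \<in> carrier_mat n n" and W: "X * Z = W * X ^\<^sub>m m" using z(5) by blast
  obtain V where Vc: "V \<in> carrier_mat n n" and V: "X * Y = X ^\<^sub>m m * V" using y(5) by blast
  have "(X * Z) * (X * Y) = W * (X ^\<^sub>m m * (X * Y))" unfolding W using Wc by (simp only: s)
  also have "\<dots> = X * Z" using y(4)[of m] by (simp add: m_def W)
  finally have 1: "(X * Z) * (X * Y) = X * Z" .
  have "(X * Z) * (X * Y) = ((X * Z) * X ^\<^sub>m m) * V" unfolding V using Vc by (simp only: s)
  also have "\<dots> = X * Y" using z(6)[of m] by (simp add: m_def V)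
  finally have e: "X * Y = X * Z" using 1 by simp
  have "Y = Y * (X * Z)" using y(3) by (simp only: e)
  also have "\<dots> = (X * Y) * Z" by (simp only: s y(2))
  also have "\<dots> = Z * (X * Z)" by (simp only: e z(2) s)
  finally show ?thesis by (simp only: z(3))
qed

lemma drazin_inverse_eq: "is_drazin_inverse X Y \<Longrightarrow> drazin_inverse X = Y"
  unfolding drazin_inverse_def using is_drazin_inverse_unique by blast

end

theory Submission
  imports Defs "Jordan_Normal_Form.Jordan_Normal_Form_Existence"
begin

text \<open>Write \<open>M = E + F\<close> with \<open>E = diag(A, D)\<close> and \<open>F\<close> the off-diagonal part. The hypotheses say that
  \<open>F\<close> commutes with \<open>E\<close> and its adjoint, hence with the core inverse \<open>P\<close> of \<open>E\<close>. The two conditions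
  on spectral idempotents read \<open>F = F\<^sup>2 K = K F\<^sup>2\<close>, where \<open>K\<close> is \<open>F\<close> times the Drazin inverse of
  \<open>F\<^sup>2\<close>; together with a \<open>G\<close> such that \<open>F G F = F\<close> and \<open>F G\<close> is Hermitian this gives \<open>F\<close> the core
  inverse \<open>K F G\<close>. So \<open>P F\<close> is a product of commuting matrices of index at most one, and being
  nilpotent it vanishes. Then \<open>E\<close> and \<open>F\<close> have orthogonal ranges and annihilate each other, and
  the core inverse of their sum is the sum of their core inverses.\<close>

section \<open>Rewriting in nested products, and the conjugate transpose\<close>

text \<open>Products are kept nested to the right by \<open>cm_simps\<close>, which hides the
  left-hand side of a rule \<open>X * Y = Z\<close> inside longer products. This form and the next
  one make such rules applicable there.\<close>

lemma mult_mat_extend: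
  fixes X Y Z W :: "'a :: semiring_0 mat"
  assumes "X * Y = Z" "X \<in> carrier_mat n n" "Y \<in> carrier_mat n n" "W \<in> carrier_mat n n"
  shows "X * (Y * W) = Z * W"
  using assms assoc_mult_mat[of X n n Y n W n] by simp

lemma mult_mat_extend3:
  fixes X Y Z V W :: "'a :: semiring_0 mat"
  assumes "X * (Y * V) = Z" "X \<in> carrier_mat n n" "Y \<in> carrier_mat n n" "V \<in> carrier_mat n n"
    "W \<in> carrier_mat n n"
  shows "X * (Y * (V * W)) = Z * W"
proof -
  have "X * (Y * V * W) = X * (Y * V) * W"
    using assms by (intro assoc_mult_mat[symmetric, of _ n n _ n _ n] mult_carrier_mat[of _ n n])
  then show ?thesis using assms by (simp add: assoc_mult_mat[of Y n n V n W n])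
qed

lemma mat_adjoint_index:
  assumes "i < dim_col X" "j < dim_row X"
  shows "mat_adjoint X $$ (i, j) = conjugate (X $$ (j, i))"
  using assms by (simp add: mat_adjoint_def mat_of_rows_def)

lemma mat_adjoint_dim [simp]:
  "dim_row (mat_adjoint X) = dim_col X" "dim_col (mat_adjoint X) = dim_row X"
  by (simp_all add: mat_adjoint_def)

lemma mat_adjoint_carrier: "X \<in> carrier_mat n m \<Longrightarrow> mat_adjoint X \<in> carrier_mat m n"
  by (rule carrier_matI) auto

lemma mat_adjoint_adjoint: "mat_adjoint (mat_adjoint X) = X"
  by (rule eq_matI) (auto simp: mat_adjoint_index)

lemma mat_adjoint_zero: "mat_adjoint (0\<^sub>m n m) = 0\<^sub>m m n"
  by (rule eq_matI) (auto simp: mat_adjoint_index)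

lemma mat_adjoint_add:
  assumes "X \<in> carrier_mat n m" "Y \<in> carrier_mat n m"
  shows "mat_adjoint (X + Y) = mat_adjoint X + mat_adjoint Y"
  using assms by (intro eq_matI) (auto simp: mat_adjoint_index conjugate_dist_add)

lemma mat_adjoint_four_block:
  assumes "A \<in> carrier_mat n1 m1" "B \<in> carrier_mat n1 m2"
    "C \<in> carrier_mat n2 m1" "D \<in> carrier_mat n2 m2"
  shows "mat_adjoint (four_block_mat A B C D) =
    four_block_mat (mat_adjoint A) (mat_adjoint C) (mat_adjoint B) (mat_adjoint D)"
  using assms by (intro eq_matI) (auto simp: mat_adjoint_index)

section \<open>Core inverses: construction, commutation and sums\<close>

lemma is_core_inverseI:
  assumes "X \<in> carrier_mat n n" "Y \<in> carrier_mat n n" "Y * (X * X) = X" "X * (Y * Y) = Y"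
    "mat_adjoint (X * Y) = X * Y"
  shows "is_core_inverse X Y"
  using assms by (auto simp: is_core_inverse_def numeral_2_eq_2)

text \<open>\<open>K * X * K\<close> is the group inverse of \<open>X\<close> and \<open>G\<close> is a (1,3)-inverse.\<close>

lemma is_core_inverse_of_index_one:
  assumes X: "X \<in> carrier_mat n n" and K: "K \<in> carrier_mat n n" and G: "G \<in> carrier_mat n n"
    and XK: "X * (X * K) = X" and KX: "K * (X * X) = X"
    and XG: "X * (G * X) = X" and ad: "mat_adjoint (X * G) = X * G"
  shows "is_core_inverse X (K * (X * G))"
proof -
  note s = cm_simps[of _ n] X K G
  note XG' = mult_mat_extend3[OF XG X G X]
  note KX' = mult_mat_extend3[OF KX K X X]
  \<comment> \<open>The two regularity conditions force \<open>K\<close> and \<open>X\<close> to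
    commute: both products equal \<open>K * X * X * K\<close>.\<close>
  have "K * X = K * (X * (X * K))" by (simp only: XK)
  also have "\<dots> = X * K" by (simp only: KX' s)
  finally have c: "K * X = X * K" .
  note c' = mult_mat_extend[OF c K X]
  have XKX: "X * (K * X) = X" by (simp only: c XK)
  note XKX' = mult_mat_extend3[OF XKX X K X]
  \<comment> \<open>The candidate and \<open>G\<close> have the same product with \<open>X\<close>,
    so the Hermitian condition is inherited from \<open>G\<close>.\<close>
  have XZ: "X * (K * (X * G)) = X * G" by (simp only: XKX' s)
  show ?thesis
  proof (rule is_core_inverseI[of _ n])
    show "X \<in> carrier_mat n n" "K * (X * G) \<in> carrier_mat n n" by (simp_all only: s)
    have "K * (X * G) * (X * X) = K * (X * (G * X) * X)" by (simp only: s)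
    then show "K * (X * G) * (X * X) = X" by (simp only: XG KX)
    have "X * (K * (X * G) * (K * (X * G))) = X * (K * (X * G)) * (K * (X * G))" by (simp only: s)
    also have "\<dots> = X * (G * (K * (X * G)))" by (simp only: XZ s)
    also have "\<dots> = X * (G * (X * (K * G)))" by (simp only: c' s)
    also have "\<dots> = K * (X * G)" by (simp only: XG' c' s)
    finally show "X * (K * (X * G) * (K * (X * G))) = K * (X * G)" .
    show "mat_adjoint (X * (K * (X * G))) = X * (K * (X * G))" by (simp only: XZ ad)
  qed
qed

text \<open>\<open>E\<close> and its adjoint commute with \<open>F\<close>, so the range of \<open>E\<close> is a reducing subspace of \<open>F\<close>:
  the orthogonal projection \<open>E * P\<close> commutes with \<open>F\<close>.\<close>

lemma core_inverse_commutes: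
  assumes core: "is_core_inverse E P" and E: "E \<in> carrier_mat n n" and F: "F \<in> carrier_mat n n"
    and EF: "E * F = F * E" and adj: "mat_adjoint E * F = F * mat_adjoint E"
  shows "P * F = F * P"
proof -
  note p = core_inverse_facts[OF core E]
  note P = p(1)
  define E' F' where "E' = mat_adjoint E" and "F' = mat_adjoint F"
  have E': "E' \<in> carrier_mat n n" and F': "F' \<in> carrier_mat n n"
    by (simp_all add: E'_def F'_def mat_adjoint_carrier E F)
  note s = cm_simps[of _ n] E F P E' F'
  have E'F: "E' * F = F * E'" using adj by (simp add: E'_def)
  have EF': "E * F' = F' * E"
    using arg_cong[OF adj, of mat_adjoint] E F
    by (simp add: mat_adjoint_mult[of _ n n _ n] mat_adjoint_carrier mat_adjoint_adjoint F'_def)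
  \<comment> \<open>\<open>E * P\<close> is the orthogonal projection onto the range of
    \<open>E\<close>, and any \<open>X\<close> commuting with \<open>E\<close> leaves that range
    invariant.\<close>
  have inv: "E * (P * (X * (E * P))) = X * (E * P)"
    if X: "X \<in> carrier_mat n n" and c: "E * X = X * E" for X
  proof -
    have "E * (P * (X * (E * P))) = E * (P * (X * E * P))" using X by (simp only: s)
    also have "\<dots> = E * (P * E) * (X * P)" using X by (simp only: c[symmetric] s)
    also have "\<dots> = (E * X) * P" using X by (simp only: p s)
    finally show ?thesis using X by (simp only: c s)
  qed
  have FQ: "E * (P * (F * (E * P))) = F * (E * P)" by (rule inv[OF F EF])
  define Q where "Q = E * P"
  have Q: "Q \<in> carrier_mat n n" "mat_adjoint Q = Q" by (simp_all only: Q_def s p(4))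
  \<comment> \<open>The range is invariant under the adjoint of \<open>F\<close> as well. Taking
    adjoints there gives \<open>Q * F = Q * F * Q\<close>, and invariance under \<open>F\<close>
    turns the right-hand side into \<open>F * Q\<close>.\<close>
  have "mat_adjoint (F' * Q) = Q * F"
    using Q F F' by (simp add: mat_adjoint_mult[of _ n n _ n] F'_def mat_adjoint_adjoint)
  moreover have "mat_adjoint (Q * (F' * Q)) = mat_adjoint (F' * Q) * mat_adjoint Q"
    by (rule mat_adjoint_mult[of _ n n _ n]) (simp_all only: Q s)
  moreover have "Q * (F' * Q) = F' * Q"
    unfolding Q_def using inv[OF F' EF'] by (simp only: s)
  ultimately have "Q * F = Q * F * Q" using Q by simp
  then have QF: "E * (P * F) = F * (E * P)" unfolding Q_def using FQ by (simp only: s)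
  have EF_ext: "F * (E * W) = E * (F * W)" if "W \<in> carrier_mat n n" for W
    using mult_mat_extend[OF EF[symmetric] F E that] E F that by (simp only: s)
  \<comment> \<open>Inserting \<open>P = E * (P * P)\<close> produces two factors \<open>E\<close>
    that can cross \<open>F\<close>; then \<open>P * (E * E) = E\<close> and
    \<open>E * (P * P) = P\<close> absorb the rest.\<close>
  have "P * F = P * (E * P) * F" by (simp only: p)
  also have "\<dots> = P * (F * (E * P))" by (simp only: s QF)
  also have "\<dots> = P * (F * (E * (E * (P * P))))" by (simp only: p)
  also have "\<dots> = (P * (E * E)) * (F * (P * P))" by (simp only: EF_ext s)
  also have "\<dots> = F * (E * (P * P))" by (simp only: p EF_ext[symmetric] s)
  also have "\<dots> = F * P" by (simp only: p)
  finally show ?thesis .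
qed

text \<open>Iterating \<open>reg\<close> splits off ever higher powers on the right:
  \<open>N = W * N ^\<^sub>m m\<close> gives
  \<open>N = T * N * N = (T * W) * N ^\<^sub>m (Suc m)\<close>. At the nilpotency exponent the
  right-hand side vanishes.\<close>

lemma nilpotent_left_regular_zero:
  fixes N T :: "'a :: semiring_1 mat"
  assumes N: "N \<in> carrier_mat n n" and T: "T \<in> carrier_mat n n"
    and reg: "N = T * (N * N)" and nil: "N ^\<^sub>m k = 0\<^sub>m n n"
  shows "N = 0\<^sub>m n n"
proof -
  have "\<exists>W \<in> carrier_mat n n. N = W * N ^\<^sub>m m" for m
  proof (induction m)
    case 0
    show ?case using N by (intro bexI[of _ N]) auto
  next
    case (Suc m)
    then obtain W where W: "W \<in> carrier_mat n n" "N = W * N ^\<^sub>m m" by blast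
    have p: "N ^\<^sub>m m \<in> carrier_mat n n" using N by simp
    have "N = T * (W * N ^\<^sub>m m * N)" using reg W(2) by simp
    also have "\<dots> = (T * W) * (N ^\<^sub>m m * N)"
      using T W(1) N p by (simp add: assoc_mult_mat[of _ n n _ n _ n] mult_carrier_mat[of _ n n _ n])
    finally show ?case using T W(1) by (intro bexI[of _ "T * W"]) auto
  qed
  then obtain W where "W \<in> carrier_mat n n" "N = W * N ^\<^sub>m k" by blast
  then show ?thesis using nil by simp
qed

text \<open>The witness of left regularity is \<open>R * E\<close>. Since \<open>E\<close> and
  \<open>P\<close> commute with \<open>F\<close>, its product with the square of
  \<open>P * F\<close> rearranges to \<open>(R * (F * F)) * (E * (P * P)) = F * P\<close>.\<close>

lemma core_inverse_mult_nilpotent_zero: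
  assumes E: "E \<in> carrier_mat n n" and F: "F \<in> carrier_mat n n"
    and P: "is_core_inverse E P" and R: "is_core_inverse F R"
    and EF: "E * F = F * E" and PF: "P * F = F * P"
    and nil: "(P * F) ^\<^sub>m k = 0\<^sub>m n n"
  shows "P * F = 0\<^sub>m n n"
proof -
  note p = core_inverse_facts[OF P E] and r = core_inverse_facts[OF R F]
  note s = cm_simps[of _ n] E F p(1) r(1)
  have EF': "E * (F * W) = F * (E * W)" if "W \<in> carrier_mat n n" for W
    using mult_mat_extend[OF EF E F that] E F that by (simp only: s)
  have PF': "P * (F * W) = F * (P * W)" if "W \<in> carrier_mat n n" for W
    using mult_mat_extend[OF PF p(1) F that] p(1) F that by (simp only: s)
  have "R * E * ((P * F) * (P * F)) = (R * (F * F)) * (E * (P * P))"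
    by (simp only: PF PF' EF' s)
  then have "P * F = R * E * ((P * F) * (P * F))" by (simp only: p r PF)
  then show ?thesis
    by (rule nilpotent_left_regular_zero[rotated 2]) (use nil in \<open>simp_all only: s\<close>)
qed

text \<open>Every mixed product of a factor from \<open>E\<close>, \<open>P\<close> with a factor
  from \<open>F\<close>, \<open>R\<close> vanishes, so the defining equations of the sum split into
  those of the summands.\<close>

lemma is_core_inverse_add:
  assumes E: "E \<in> carrier_mat n n" and F: "F \<in> carrier_mat n n"
    and P: "is_core_inverse E P" and R: "is_core_inverse F R"
    and com: "E * F = F * E"
    and PF: "P * F = 0\<^sub>m n n" and FP: "F * P = 0\<^sub>m n n"
  shows "is_core_inverse (E + F) (P + R)"
proof -
  note p = core_inverse_facts[OF P E] and r = core_inverse_facts[OF R F]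
  note s = cm_simps[of _ n] E F p(1) r(1)
  note d = add_mult_distrib_mat[of _ n n _ _ n] mult_add_distrib_mat[of _ n n _ n]
    add_carrier_mat[of _ n n] s
  have z: "0\<^sub>m n n * X = 0\<^sub>m n n" "X * 0\<^sub>m n n = 0\<^sub>m n n" "X + 0\<^sub>m n n = X" "0\<^sub>m n n + X = X"
    if "X \<in> carrier_mat n n" for X :: "complex mat"
    using that by simp_all
  have "F * E = (F * P) * (E * E)" by (simp only: s p)
  also have "\<dots> = 0\<^sub>m n n" by (simp only: FP z s)
  finally have FE: "F * E = 0\<^sub>m n n" .
  have EF: "E * F = 0\<^sub>m n n" by (simp only: com FE)
  \<comment> \<open>Both \<open>E * P\<close> and \<open>F * R\<close> are Hermitian, so their
    product in one order is the adjoint of the product in the other; \<open>PF\<close> kills one of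
    them.\<close>
  have "mat_adjoint ((E * P) * (F * R)) = mat_adjoint (F * R) * mat_adjoint (E * P)"
    by (rule mat_adjoint_mult[of _ n n _ n]) (simp_all only: s)
  then have "F * R * (E * P) = mat_adjoint ((E * P) * (F * R))" by (simp only: p r)
  also have "(E * P) * (F * R) = E * (P * F) * R" by (simp only: s)
  also have "\<dots> = 0\<^sub>m n n" by (simp only: PF z s)
  finally have FREP: "F * R * (E * P) = 0\<^sub>m n n" by (simp only: mat_adjoint_zero)
  have "R * E = R * (F * R) * (E * (P * E))" by (simp only: p r)
  also have "\<dots> = R * (F * R * (E * P)) * E" by (simp only: s)
  also have "\<dots> = 0\<^sub>m n n" by (simp only: FREP z s)
  finally have RE: "R * E = 0\<^sub>m n n" .
  have "R * P = (R * E) * (P * P)" by (simp only: s p)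
  also have "\<dots> = 0\<^sub>m n n" by (simp only: RE z s)
  finally have RP: "R * P = 0\<^sub>m n n" .
  have "P * R = (P * F) * (R * R)" by (simp only: s r)
  also have "\<dots> = 0\<^sub>m n n" by (simp only: PF z s)
  finally have PR: "P * R = 0\<^sub>m n n" .
  have "E * R = (E * F) * (R * R)" by (simp only: s r)
  also have "\<dots> = 0\<^sub>m n n" by (simp only: EF z s)
  finally have ER: "E * R = 0\<^sub>m n n" .
  note ext = mult_mat_extend[where n = n, OF PF] mult_mat_extend[where n = n, OF RE]
    mult_mat_extend[where n = n, OF ER] mult_mat_extend[where n = n, OF FP]
  have MM: "(E + F) * (E + F) = E * E + F * F" by (simp only: d EF FE z)
  have RR: "(P + R) * (P + R) = P * P + R * R" by (simp only: d PR RP z)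
  have MR: "(E + F) * (P + R) = E * P + F * R" by (simp only: d ER FP z)
  show ?thesis
  proof (rule is_core_inverseI[of _ n])
    show "E + F \<in> carrier_mat n n" "P + R \<in> carrier_mat n n" by (simp_all only: d)
    show "(P + R) * ((E + F) * (E + F)) = E + F" by (simp only: MM d ext p r z)
    show "(E + F) * ((P + R) * (P + R)) = P + R" by (simp only: RR d ext p r z)
    show "mat_adjoint ((E + F) * (P + R)) = (E + F) * (P + R)"
      by (simp add: MR mat_adjoint_add[of _ n n] s p(4) r(4))
  qed
qed

section \<open>Existence of Drazin inverses by Jordan normal form\<close>

text \<open>A block with eigenvalue 0 is nilpotent and has Drazin inverse 0; any other block is
  invertible, with its ordinary inverse.\<close>

lemma drazin_inverse_exists_jordan_block:
  "\<exists>Y. is_drazin_inverse (jordan_block m a) Y"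
proof (cases "a = 0")
  case True
  have "jordan_block m a ^\<^sub>m m = 0\<^sub>m m m"
    unfolding True jordan_block_zero_pow by (rule eq_matI) auto
  then have "is_drazin_inverse (jordan_block m a) (0\<^sub>m m m)"
    by (auto simp: is_drazin_inverse_def intro!: exI[of _ m])
  then show ?thesis ..
next
  case False
  let ?J = "jordan_block m a"
  have J: "?J \<in> carrier_mat m m" by simp
  have "det ?J \<noteq> 0"
    using False by (subst det_upper_triangular[of _ m]) (auto simp: prod_list_diag_prod)
  from det_non_zero_imp_unit[OF J this, where b = "()"] obtain Y
    where "Y \<in> carrier_mat m m" "Y * ?J = 1\<^sub>m m" "?J * Y = 1\<^sub>m m"
    by (auto simp: Units_def ring_mat_def)
  then have "is_drazin_inverse ?J Y"
    by (auto simp: is_drazin_inverse_def intro!: exI[of _ 0])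
  then show ?thesis ..
qed

text \<open>Allowing all large exponents lets two diagonal blocks share one.\<close>

lemma is_drazin_inverse_pow:
  assumes Y: "is_drazin_inverse X Y" and X: "X \<in> carrier_mat n n"
  obtains k where "\<And>m. k \<le> m \<Longrightarrow> X ^\<^sub>m (Suc m) * Y = X ^\<^sub>m m"
proof -
  obtain k where k: "Y \<in> carrier_mat n n" "\<And>m. k \<le> m \<Longrightarrow> X ^\<^sub>m m * (X * Y) = X ^\<^sub>m m"
    by (rule drazin_inverse_facts[OF Y X]) blast
  show ?thesis
    by (rule that[of k]) (use k X in \<open>simp add: assoc_mult_mat[of _ n n _ n _ n]\<close>)
qed

lemma is_drazin_inverse_block_diag:
  assumes Y1: "is_drazin_inverse X1 Y1" and X1: "X1 \<in> carrier_mat n n"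
    and Y2: "is_drazin_inverse X2 Y2" and X2: "X2 \<in> carrier_mat m m"
  shows "is_drazin_inverse (four_block_mat X1 (0\<^sub>m n m) (0\<^sub>m m n) X2)
    (four_block_mat Y1 (0\<^sub>m n m) (0\<^sub>m m n) Y2)"
proof -
  have Y: "Y1 \<in> carrier_mat n n" "Y2 \<in> carrier_mat m m"
    using assms by (auto simp: is_drazin_inverse_def)
  obtain k1 where k1: "\<And>k. k1 \<le> k \<Longrightarrow> X1 ^\<^sub>m (Suc k) * Y1 = X1 ^\<^sub>m k"
    using is_drazin_inverse_pow[OF Y1 X1] by blast
  obtain k2 where k2: "\<And>k. k2 \<le> k \<Longrightarrow> X2 ^\<^sub>m (Suc k) * Y2 = X2 ^\<^sub>m k"
    using is_drazin_inverse_pow[OF Y2 X2] by blast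
  have mult: "four_block_mat U (0\<^sub>m n m) (0\<^sub>m m n) V * four_block_mat U' (0\<^sub>m n m) (0\<^sub>m m n) V'
      = four_block_mat (U * U') (0\<^sub>m n m) (0\<^sub>m m n) (V * V')"
    if "U \<in> carrier_mat n n" "U' \<in> carrier_mat n n" "V \<in> carrier_mat m m" "V' \<in> carrier_mat m m"
    for U U' V V' :: "complex mat"
    using that by (subst mult_four_block_mat[of _ n n _ m _ m _ _ n _ m]) auto
  have p: "X1 ^\<^sub>m k \<in> carrier_mat n n" "X2 ^\<^sub>m k \<in> carrier_mat m m" for k
    using X1 X2 by simp_all
  let ?X = "four_block_mat X1 (0\<^sub>m n m) (0\<^sub>m m n) X2"
  let ?Y = "four_block_mat Y1 (0\<^sub>m n m) (0\<^sub>m m n) Y2"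
  have "?X ^\<^sub>m (Suc (max k1 k2)) * ?Y = ?X ^\<^sub>m (max k1 k2)"
    unfolding pow_four_block_mat[OF X1 X2] mult[OF p(1) Y(1) p(2) Y(2)]
    by (subst k1, simp, subst k2, simp, rule refl)
  moreover have "?X * ?Y = ?Y * ?X" "?Y * ?X * ?Y = ?Y"
    using Y1 Y2 X1 X2 Y unfolding is_drazin_inverse_def
    by (simp_all add: mult mult_carrier_mat[of _ n n _ n] mult_carrier_mat[of _ m m _ m]
      del: assoc_mult_mat)
  ultimately show ?thesis
    using X1 X2 Y by (auto simp only: is_drazin_inverse_def index_mat_four_block four_block_carrier_mat
        square_mat.simps carrier_matD)
qed

lemma drazin_inverse_exists_jordan_matrix:
  "\<exists>Y. is_drazin_inverse (jordan_matrix n_as) Y"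
proof (induction n_as)
  case Nil
  have "is_drazin_inverse (jordan_matrix []) (jordan_matrix [])"
    by (auto simp: is_drazin_inverse_def jordan_matrix_def intro!: exI[of _ "Suc 0"])
  then show ?case ..
next
  case (Cons na n_as)
  obtain m a where na: "na = (m, a)" by (cases na)
  obtain Y1 Y2 where Y1: "is_drazin_inverse (jordan_block m a) Y1"
    and Y2: "is_drazin_inverse (jordan_matrix n_as) Y2"
    using drazin_inverse_exists_jordan_block Cons by blast
  have "jordan_matrix n_as \<in> carrier_mat (sum_list (map fst n_as)) (sum_list (map fst n_as))"
    by (rule carrier_matI) simp_all
  from is_drazin_inverse_block_diag[OF Y1 jordan_block_carrier Y2 this] have "is_drazin_inverse (jordan_matrix (na # n_as))
      (four_block_mat Y1 (0\<^sub>m m (sum_list (map fst n_as))) (0\<^sub>m (sum_list (map fst n_as)) m) Y2)"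
    unfolding na jordan_matrix_Cons .
  then show ?case ..
qed

text \<open>Conjugation is multiplicative because \<open>Q * P\<close> is the identity, so it
  carries over each defining equation, including the one with powers.\<close>

lemma is_drazin_inverse_similar:
  assumes wit: "similar_mat_wit X J P Q" and Y: "is_drazin_inverse J Y"
  shows "is_drazin_inverse X (P * Y * Q)"
proof -
  define n where "n = dim_row X"
  note w = similar_mat_witD[OF n_def wit]
  have Yc: "Y \<in> carrier_mat n n" and J: "J \<in> carrier_mat n n"
    using Y w by (auto simp: is_drazin_inverse_def)
  obtain k where k: "J ^\<^sub>m (Suc k) * Y = J ^\<^sub>m k" using Y by (auto simp: is_drazin_inverse_def)
  have p: "J ^\<^sub>m i \<in> carrier_mat n n" for i using J by simp
  have mult: "(P * U * Q) * (P * V * Q) = P * (U * V) * Q"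
    if "U \<in> carrier_mat n n" "V \<in> carrier_mat n n" for U V
  proof -
    note s = cm_simps[of _ n] that w(6,7)
    have "(P * U * Q) * (P * V * Q) = P * (U * ((Q * P) * V)) * Q" by (simp only: s)
    then show ?thesis using that(2) by (simp add: w(2))
  qed
  have X: "X ^\<^sub>m i = P * J ^\<^sub>m i * Q" for i
    using similar_mat_wit_pow[OF wit] by (auto simp: similar_mat_wit_def Let_def)
  have "X ^\<^sub>m (Suc k) * (P * Y * Q) = X ^\<^sub>m k" unfolding X mult[OF p Yc] k ..
  moreover have "X * (P * Y * Q) = P * Y * Q * X" "P * Y * Q * X * (P * Y * Q) = P * Y * Q"
    using Y J Yc by (simp_all add: w(3) mult mult_carrier_mat[of _ n n _ n] is_drazin_inverse_def
        del: assoc_mult_mat)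
  moreover have "X \<in> carrier_mat n n" "P * Y * Q \<in> carrier_mat n n"
    using w Yc mult_carrier_mat[of _ n n _ n] by simp_all
  ultimately show ?thesis unfolding is_drazin_inverse_def by auto
qed

text \<open>Over the complex numbers the characteristic polynomial splits, so a Jordan form exists.
  With uniqueness this makes the definite description in \<open>drazin_inverse\<close>
  meaningful.\<close>

lemma is_drazin_inverse_drazin_inverse:
  assumes X: "X \<in> carrier_mat n n"
  shows "is_drazin_inverse X (drazin_inverse X)"
proof -
  obtain as where "char_poly X = (\<Prod>a\<leftarrow>as. [:- a, 1:])"
    using char_poly_factorized[OF X] by blast
  then obtain n_as where "jordan_nf X n_as" using jordan_nf_exists[OF X] by blast
  then obtain P Q where "similar_mat_wit X (jordan_matrix n_as) P Q"
    by (auto simp: jordan_nf_def similar_mat_def)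
  then obtain Y where "is_drazin_inverse X Y"
    using drazin_inverse_exists_jordan_matrix is_drazin_inverse_similar by blast
  then show ?thesis using drazin_inverse_eq by simp
qed

section \<open>Core inverses of antidiagonal and diagonal block matrices\<close>

lemma has_core_inverse_antidiag:
  assumes B: "B \<in> carrier_mat n n" and C: "C \<in> carrier_mat n n"
    and hB: "has_core_inverse B" and hC: "has_core_inverse C"
    and Bpi: "B * spectral_idempotent (C * B) = 0\<^sub>m n n"
    and Cpi: "C * spectral_idempotent (B * C) = 0\<^sub>m n n"
  shows "has_core_inverse (four_block_mat (0\<^sub>m n n) B C (0\<^sub>m n n))"
proof -
  obtain B' C' where B'c: "is_core_inverse B B'" and C'c: "is_core_inverse C C'"
    using hB hC by (auto simp: has_core_inverse_def)
  note b = core_inverse_facts[OF B'c B] and c = core_inverse_facts[OF C'c C]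
  \<comment> \<open>With \<open>U\<close> the Drazin inverse of \<open>Y * X\<close>, the vanishing
    of \<open>X\<close> times the spectral idempotent says that \<open>X\<close> absorbs
    \<open>Y * X * U\<close> on the right. It is used for \<open>B\<close>, \<open>C\<close> and for
    \<open>C\<close>, \<open>B\<close>.\<close>
  have regular: "X * (Y * (X * U)) = X \<and> U \<in> carrier_mat n n \<and> Y * (X * U) = U * (Y * X)"
    if X: "X \<in> carrier_mat n n" and Y: "Y \<in> carrier_mat n n" and U: "U = drazin_inverse (Y * X)"
      and pi: "X * spectral_idempotent (Y * X) = 0\<^sub>m n n" for X Y U
  proof -
    have YX: "Y * X \<in> carrier_mat n n" using X Y by simp
    note U' = is_drazin_inverse_drazin_inverse[OF YX, folded U]
    then have Uc: "U \<in> carrier_mat n n" and com: "Y * X * U = U * (Y * X)"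
      using X Y by (auto simp: is_drazin_inverse_def)
    have YXU: "Y * X * U \<in> carrier_mat n n" using YX Uc by simp
    have "X - X * (Y * X * U) = 0\<^sub>m n n"
      using pi X Y YXU by (simp add: spectral_idempotent_def U[symmetric] mult_minus_distrib_mat[of _ n n _ n])
    then have "X * (Y * X * U) = X"
      using X YXU by (auto simp: mat_eq_iff)
    then show ?thesis using X Y Uc com by (simp add: assoc_mult_mat[of _ n n _ n _ n])
  qed
  define U V where "U = drazin_inverse (C * B)" and "V = drazin_inverse (B * C)"
  have u: "B * (C * (B * U)) = B" "C * (B * U) = U * (C * B)"
    and v: "C * (B * (C * V)) = C" "B * (C * V) = V * (B * C)"
    and UV: "U \<in> carrier_mat n n" "V \<in> carrier_mat n n"
    using regular[OF B C U_def Bpi] regular[OF C B V_def Cpi] by blast+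
  note s = cm_simps[of _ n] B C UV b(1) c(1)
  let ?o = "0\<^sub>m n n :: complex mat"
  have mult: "four_block_mat X1 X2 X3 X4 * four_block_mat Y1 Y2 Y3 Y4
      = four_block_mat (X1 * Y1 + X2 * Y3) (X1 * Y2 + X2 * Y4) (X3 * Y1 + X4 * Y3) (X3 * Y2 + X4 * Y4)"
    if "X1 \<in> carrier_mat n n" "X2 \<in> carrier_mat n n" "X3 \<in> carrier_mat n n" "X4 \<in> carrier_mat n n"
      "Y1 \<in> carrier_mat n n" "Y2 \<in> carrier_mat n n" "Y3 \<in> carrier_mat n n" "Y4 \<in> carrier_mat n n"
    for X1 X2 X3 X4 Y1 Y2 Y3 Y4 :: "complex mat"
    using that by (rule mult_four_block_mat)
  let ?F = "four_block_mat ?o B C ?o"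
  \<comment> \<open>The square of \<open>?F\<close> is diagonal with blocks \<open>B * C\<close> and
    \<open>C * B\<close>, whose Drazin inverses are \<open>V\<close> and \<open>U\<close>;
    multiplying by \<open>?F\<close> gives \<open>?K\<close>. The blocks of \<open>?G\<close> are
    placed so that \<open>?F * ?G\<close> is diagonal with the Hermitian blocks
    \<open>B * B'\<close> and \<open>C * C'\<close>.\<close>
  let ?K = "four_block_mat ?o (B * U) (C * V) ?o"
  let ?G = "four_block_mat ?o C' B' ?o"
  have "is_core_inverse ?F (?K * (?F * ?G))"
  proof (rule is_core_inverse_of_index_one[of _ "n + n"])
    show "?F \<in> carrier_mat (n + n) (n + n)" "?K \<in> carrier_mat (n + n) (n + n)"
      "?G \<in> carrier_mat (n + n) (n + n)"
      using s(3-) by auto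
    show "?F * (?F * ?K) = ?F" using s(3-) u(1) v(1) by (simp add: mult)
    have "B * U * (C * B) = B" "C * V * (B * C) = C"
      using u v by (simp_all only: s)
    then show "?K * (?F * ?F) = ?F" using s(3-) by (simp add: mult)
    show "?F * (?G * ?F) = ?F" using s(3-) b c by (simp add: mult)
    show "mat_adjoint (?F * ?G) = ?F * ?G"
      using s(3-) b c by (simp add: mult mat_adjoint_four_block[of _ n n _ n _ n] mat_adjoint_zero)
  qed
  then show ?thesis unfolding has_core_inverse_def ..
qed

lemma is_core_inverse_diag:
  assumes A: "A \<in> carrier_mat n n" and D: "D \<in> carrier_mat n n"
    and A': "is_core_inverse A A'" and D': "is_core_inverse D D'"
  shows "is_core_inverse (four_block_mat A (0\<^sub>m n n) (0\<^sub>m n n) D)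
    (four_block_mat A' (0\<^sub>m n n) (0\<^sub>m n n) D')"
proof -
  note a = core_inverse_facts[OF A' A] and d = core_inverse_facts[OF D' D]
  show ?thesis
    by (rule is_core_inverseI[of _ "n + n"])
      (use A D a d in \<open>auto simp: mult_four_block_mat[of _ n n _ n _ n _ _ n _ n]
        mat_adjoint_four_block[of _ n n _ n _ n] mat_adjoint_zero\<close>)
qed

section \<open>Powers of products, and assembly of the proof\<close>

text \<open>Transfers nilpotency from \<open>X * Y\<close> to \<open>Y * X\<close>, at the cost of
  one in the exponent.\<close>

lemma pow_mat_mult_swap:
  fixes X Y :: "'a :: semiring_1 mat"
  assumes X: "X \<in> carrier_mat n n" and Y: "Y \<in> carrier_mat n n"
  shows "(Y * X) ^\<^sub>m (Suc k) = Y * (X * Y) ^\<^sub>m k * X"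
proof (induction k)
  case 0
  show ?case using X Y by simp
next
  case (Suc k)
  have p: "(X * Y) ^\<^sub>m k \<in> carrier_mat n n" using X Y by simp
  have "(Y * X) ^\<^sub>m (Suc (Suc k)) = Y * (X * Y) ^\<^sub>m k * X * (Y * X)"
    using Suc by simp
  also have "\<dots> = Y * (X * Y) ^\<^sub>m (Suc k) * X"
    using X Y p by (simp add: assoc_mult_mat[of _ n n _ n _ n] mult_carrier_mat[of _ n n _ n])
  finally show ?case .
qed

lemma pow_mat_pow:
  fixes X :: "'a :: semiring_1 mat"
  assumes X: "X \<in> carrier_mat n n"
  shows "(X ^\<^sub>m i) ^\<^sub>m j = X ^\<^sub>m (i * j)"
proof -
  interpret semiring "ring_mat TYPE('a) n ()" by (rule semiring_mat)
  have p: "X ^\<^sub>m i \<in> carrier_mat n n" using X by simp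
  show ?thesis
    using nat_pow_pow[of X i j] X
    by (simp add: pow_mat_ring_pow[OF p, of _ "()"] ring_mat_simps flip: pow_mat_ring_pow[OF X])
qed

lemma zero_four_block_mat:
  "four_block_mat (0\<^sub>m n1 m1) (0\<^sub>m n1 m2) (0\<^sub>m n2 m1) (0\<^sub>m n2 m2) = 0\<^sub>m (n1 + n2) (m1 + m2)"
  by (rule eq_matI) auto

theorem theorem4p2:
  fixes n :: nat and A B C D M :: "complex mat"
  assumes "A \<in> carrier_mat n n" and "B \<in> carrier_mat n n"
    and "C \<in> carrier_mat n n" and "D \<in> carrier_mat n n"
    and "has_core_inverse A" and "has_core_inverse B"
    and "has_core_inverse C" and "has_core_inverse D"
    and "M = four_block_mat A B C D"
    and "A * B = B * D" and "D * C = C * A"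
    and "mat_adjoint A * B = B * mat_adjoint D"
    and "mat_adjoint D * C = C * mat_adjoint A"
    and "B * spectral_idempotent (C * B) = 0\<^sub>m n n"
    and "C * spectral_idempotent (B * C) = 0\<^sub>m n n"
    and "nilpotent_mat (core_inverse A * B * core_inverse D * C)"
  shows "has_core_inverse M"
proof -
  note A = assms(1) and B = assms(2) and C = assms(3) and D = assms(4)
  obtain A' D' where A': "is_core_inverse A A'" and D': "is_core_inverse D D'"
    using assms(5,8) by (auto simp: has_core_inverse_def)
  have A'c: "A' \<in> carrier_mat n n" and D'c: "D' \<in> carrier_mat n n"
    using core_inverse_facts(1) A' D' A D by blast+
  let ?o = "0\<^sub>m n n :: complex mat"
  define E F P where "E = four_block_mat A ?o ?o D" and "F = four_block_mat ?o B C ?o"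
    and "P = four_block_mat A' ?o ?o D'"
  have E: "E \<in> carrier_mat (n + n) (n + n)" and F: "F \<in> carrier_mat (n + n) (n + n)"
    using A B C D by (auto simp: E_def F_def)
  have M: "M = E + F"
    using A B C D by (simp add: assms(9) E_def F_def add_four_block_mat[of _ n n _ n _ n])
  note ms = mult_four_block_mat[of _ n n _ n _ n _ _ n _ n]
  have P: "is_core_inverse E P" unfolding E_def P_def by (rule is_core_inverse_diag[OF A D A' D'])
  obtain R where R: "is_core_inverse F R"
    using has_core_inverse_antidiag[OF B C assms(6,7,14,15)] by (auto simp: has_core_inverse_def F_def)
  have EF: "E * F = F * E"
    using A B C D assms(10,11) by (simp add: E_def F_def ms)
  have adj: "mat_adjoint E * F = F * mat_adjoint E"
    using A B C D assms(12,13)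
    by (simp add: E_def F_def ms mat_adjoint_four_block[of _ n n _ n _ n] mat_adjoint_zero
        mat_adjoint_carrier)
  have PF: "P * F = F * P" by (rule core_inverse_commutes[OF P E F EF adj])
  \<comment> \<open>These are the off-diagonal blocks of \<open>P * F\<close>. Its square is
    diagonal with blocks \<open>X * Y\<close> and \<open>Y * X\<close>, and the nilpotency
    hypothesis concerns the first.\<close>
  define X Y where "X = A' * B" and "Y = D' * C"
  have X: "X \<in> carrier_mat n n" and Y: "Y \<in> carrier_mat n n"
    using A'c D'c B C by (simp_all add: X_def Y_def)
  have "A' * B * D' * C = X * Y"
    using A'c D'c B C by (simp add: X_def Y_def assoc_mult_mat[of _ n n _ n _ n])
  then obtain k where k: "(X * Y) ^\<^sub>m k = ?o"
    using assms(16) X Y by (auto simp: nilpotent_mat_def core_inverse_eq[OF A'] core_inverse_eq[OF D'])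
  \<comment> \<open>The exponent is raised by one to agree with the one available for
    \<open>Y * X\<close>.\<close>
  have XYk: "(X * Y) ^\<^sub>m (Suc k) = ?o" using k X Y by simp
  have YXk: "(Y * X) ^\<^sub>m (Suc k) = ?o" unfolding pow_mat_mult_swap[OF X Y] k using X Y by simp
  have "P * F = four_block_mat ?o X Y ?o"
    using A'c D'c B C by (simp add: P_def F_def ms X_def Y_def)
  then have PFc: "P * F \<in> carrier_mat (n + n) (n + n)"
    and PF2: "(P * F) ^\<^sub>m 2 = four_block_mat (X * Y) ?o ?o (Y * X)"
    using X Y by (simp_all add: numeral_2_eq_2 ms)
  have "((P * F) ^\<^sub>m 2) ^\<^sub>m (Suc k) = 0\<^sub>m (n + n) (n + n)"
    unfolding PF2 using X Y
    by (subst pow_four_block_mat[of _ n _ n]) (simp_all only: XYk YXk mult_carrier_mat zero_four_block_mat)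
  then have "(P * F) ^\<^sub>m (2 * Suc k) = 0\<^sub>m (n + n) (n + n)"
    by (subst (asm) pow_mat_pow[OF PFc])
  then have "P * F = 0\<^sub>m (n + n) (n + n)"
    by (rule core_inverse_mult_nilpotent_zero[OF E F P R EF PF])
  then have "is_core_inverse (E + F) (P + R)"
    by (intro is_core_inverse_add[OF E F P R EF]) (simp_all flip: PF)
  then show ?thesis unfolding M has_core_inverse_def ..
qed

end
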